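(* Let $f \in C^\infty[0,1]$ and $0 < \alpha < 1$. There exists a constant $C$, independent of $\varepsilon$ and $N$ (it may depend on $f$ and $\alpha$), such that the following holds for every $\varepsilon$ with $0 < \varepsilon \le 1$ and every even positive integer $N$ with $(2/\alpha)\varepsilon \ln N \le 1/2$. Let $u$ be the solution of the boundary value problem $$-\varepsilon u''(x) + u'(x) = f(x) \quad (0 < x < 1), \qquad u(0) = 0, \quad u(1) = 0,$$ and let $(u_i^N)_{i=0}^N$ be the solution of the simple upwind finite difference scheme for this problem on the Shishkin mesh $0 = x_0 < x_1 < \dots < x_N = 1$ with parameters $\varepsilon$, $\alpha$, $N$. Then, writing $u_i = u(x_i)$, $$|u_i - u_i^N| \le C N^{-1} \ln N \qquad \text{for all } i = 0, \ldots, N.$$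
   Context: Shishkin mesh: let $N$ be an even positive integer and let $\sigma = \min\{1/2,\ (2/\alpha)\varepsilon \ln N\}$; it is assumed throughout that $\sigma = (2/\alpha)\varepsilon \ln N$, i.e. $(2/\alpha)\varepsilon\ln N \le 1/2$. Here $\alpha$ is a fixed positive lower bound for the convection coefficient, which is identically $1$, so $0<\alpha<1$. Each of the intervals $[0, 1-\sigma]$ and $[1-\sigma, 1]$ is divided into $N/2$ subintervals of equal length by equidistant mesh points. This gives mesh points $0 = x_0 < x_1 < \cdots < x_N = 1$ with $x_{N/2} = 1-\sigma$. (If $N = 2$, the mesh points are $0, 1-\sigma, 1$.) Write $h_i = x_i - x_{i-1}$ for $i = 1, \dots, N$. Simple upwind scheme: the first derivative is approximated by the one-sided difference on the side away from the boundary layer at $x=1$, and the second derivative by the standard three-point difference on the mesh. That is, $(u_i^N)_{i=0}^N$ satisfies $u_0^N = u_N^N = 0$ and, for $i = 1, \dots, N-1$, $$-\varepsilon\, \frac{2}{h_i + h_{i+1}} \left( \frac{u_{i+1}^N - u_i^N}{h_{i+1}} - \frac{u_i^N - u_{i-1}^N}{h_i} \right) + \frac{u_i^N - u_{i-1}^N}{h_i} = f(x_i).$$ *)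

theory Defs
  imports "HOL-Analysis.Analysis"
begin

text \<open>
  The class of infinitely differentiable functions on a closed interval, with one-sided derivatives
  at the end points: \<open>D k\<close> is the derivative of order \<open>k\<close>. Nothing is required of \<open>f\<close> outside
  the interval.
\<close>

definition smooth_on_interval :: "real \<Rightarrow> real \<Rightarrow> (real \<Rightarrow> real) \<Rightarrow> bool" where
  "smooth_on_interval a b f \<longleftrightarrow>
     (\<exists>D :: nat \<Rightarrow> real \<Rightarrow> real.
        (\<forall>x\<in>{a..b}. D 0 x = f x) \<and>
        (\<forall>k. \<forall>x\<in>{a..b}. (D k has_real_derivative D (Suc k) x) (at x within {a..b})))"

text \<open>
  Classical solutions: \<open>u\<close> is continuous up to the boundary and twice differentiable in the open
  interval.
\<close>

definition bvp_solution :: "real \<Rightarrow> (real \<Rightarrow> real) \<Rightarrow> (real \<Rightarrow> real) \<Rightarrow> bool" where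
  "bvp_solution \<epsilon> f u \<longleftrightarrow>
     continuous_on {0..1} u \<and>
     (\<forall>x\<in>{0<..<1}. u differentiable (at x) \<and> deriv u differentiable (at x) \<and>
        - \<epsilon> * deriv (deriv u) x + deriv u x = f x) \<and>
     u 0 = 0 \<and> u 1 = 0"

definition shishkin_sigma :: "real \<Rightarrow> real \<Rightarrow> nat \<Rightarrow> real" where
  "shishkin_sigma \<epsilon> \<alpha> N = min (1 / 2) ((2 / \<alpha>) * \<epsilon> * ln (real N))"

text \<open>The mesh is meaningful for even positive \<open>N\<close> and indices \<open>i \<le> N\<close> only.\<close>

definition shishkin_mesh :: "real \<Rightarrow> real \<Rightarrow> nat \<Rightarrow> nat \<Rightarrow> real" where
  "shishkin_mesh \<epsilon> \<alpha> N i =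
     (let \<sigma> = shishkin_sigma \<epsilon> \<alpha> N; n = real N / 2 in
      if i \<le> N div 2 then real i * ((1 - \<sigma>) / n)
      else (1 - \<sigma>) + (real i - n) * (\<sigma> / n))"

text \<open>Used for \<open>i \<ge> 1\<close> only, since \<open>i - 1\<close> is truncated subtraction.\<close>

definition mesh_width :: "(nat \<Rightarrow> real) \<Rightarrow> nat \<Rightarrow> real" where
  "mesh_width x i = x i - x (i - 1)"

definition upwind_solution ::
  "real \<Rightarrow> (real \<Rightarrow> real) \<Rightarrow> nat \<Rightarrow> (nat \<Rightarrow> real) \<Rightarrow> (nat \<Rightarrow> real) \<Rightarrow> bool" where
  "upwind_solution \<epsilon> f N x v \<longleftrightarrow>
     v 0 = 0 \<and> v N = 0 \<and>
     (\<forall>i\<in>{1..N - 1}.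
        - \<epsilon> * (2 / (mesh_width x i + mesh_width x (i + 1))) *
            ((v (i + 1) - v i) / mesh_width x (i + 1) - (v i - v (i - 1)) / mesh_width x i)
          + (v i - v (i - 1)) / mesh_width x i = f (x i))"

end

theory Submission
  imports Defs
begin

text \<open>
  The solution splits as \<open>u = S + c (q - q 0)\<close> with the layer function \<open>q x = exp (- (1 - x) / \<epsilon>)\<close>
  and a part \<open>S\<close> for which \<open>S''\<close> and \<open>\<epsilon> S'''\<close> are bounded independently of \<open>\<epsilon>\<close>.
  On a mesh with two step sizes \<open>H\<close>, \<open>h\<close> the upwind scheme has an explicit homogeneous solution \<open>Z\<close>.
  Near the layer it is \<open>(1 + h / \<epsilon>) ^ - (N - i)\<close>, which differs from \<open>q (x\<^sub>i)\<close> by at most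
  \<open>h / \<epsilon> = O(N\<^sup>-\<^sup>1 ln N)\<close>; left of the transition point both \<open>Z\<close> and \<open>q\<close> are bounded by
  \<open>(1 + h / \<epsilon>) ^ - (N / 2) = O(N\<^sup>-\<^sup>1)\<close>. The mesh function \<open>S - v + c (Z - q 0)\<close> has
  truncation error \<open>O(N\<^sup>-\<^sup>1)\<close> and small boundary values, so the discrete comparison principle
  with a linear barrier bounds it.
\<close>

section \<open>The upwind operator: comparison principle and stability\<close>

text \<open>The expression is that of \<open>upwind_solution\<close> verbatim, so unfolding turns
  the scheme into \<open>upwind_operator \<epsilon> x v i = f (x i)\<close>.\<close>

definition upwind_operator :: "real \<Rightarrow> (nat \<Rightarrow> real) \<Rightarrow> (nat \<Rightarrow> real) \<Rightarrow> nat \<Rightarrow> real" where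
  "upwind_operator \<epsilon> x v i =
     - \<epsilon> * (2 / (mesh_width x i + mesh_width x (i + 1))) *
         ((v (i + 1) - v i) / mesh_width x (i + 1) - (v i - v (i - 1)) / mesh_width x i)
       + (v i - v (i - 1)) / mesh_width x i"

lemma upwind_operator_linear:
  "upwind_operator \<epsilon> x (\<lambda>j. a * v j + b * w j) i =
     a * upwind_operator \<epsilon> x v i + b * upwind_operator \<epsilon> x w i"
proof -
  have "((a * v k + b * w k) - (a * v j + b * w j)) / d
      = a * ((v k - v j) / d) + b * ((w k - w j) / d)" for j k d
    by (simp add: add_divide_distrib diff_divide_distrib algebra_simps)
  moreover have "- \<epsilon> * k * ((a * p + b * q) - (a * r + b * s)) + (a * r + b * s)
      = a * (- \<epsilon> * k * (p - r) + r) + b * (- \<epsilon> * k * (q - s) + s)" for k p q r s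
    by (simp add: algebra_simps)
  ultimately show ?thesis
    unfolding upwind_operator_def by (simp only:)
qed

lemma upwind_operator_const: "upwind_operator \<epsilon> x (\<lambda>j. c) i = 0"
  by (simp add: upwind_operator_def)

text \<open>The difference quotients of the mesh points themselves are all 1, so the second
  difference drops out. This supplies the linear barrier for the stability bound.\<close>

lemma upwind_operator_mesh:
  assumes "mesh_width x i > 0" "mesh_width x (i + 1) > 0"
  shows "upwind_operator \<epsilon> x x i = 1"
  using assms by (simp add: upwind_operator_def mesh_width_def)

text \<open>The homogeneous scheme is a recursion for consecutive difference quotients. In this form
  a candidate is checked node by node from its increments.\<close>

lemma upwind_operator_eq_0:
  assumes "\<epsilon> > 0" "mesh_width x i > 0" "mesh_width x (i + 1) > 0"
    and "(v (i + 1) - v i) / mesh_width x (i + 1) =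
           (v i - v (i - 1)) / mesh_width x i *
             (1 + (mesh_width x i + mesh_width x (i + 1)) / (2 * \<epsilon>))"
  shows "upwind_operator \<epsilon> x v i = 0"
proof -
  define d k where "d = (v i - v (i - 1)) / mesh_width x i"
    and "k = mesh_width x i + mesh_width x (i + 1)"
  have "k > 0" using assms by (simp add: k_def)
  have "upwind_operator \<epsilon> x v i = - \<epsilon> * (2 / k) * (d * (1 + k / (2 * \<epsilon>)) - d) + d"
    unfolding upwind_operator_def using assms(4) by (simp add: d_def k_def)
  also have "\<dots> = 0"
    using \<open>k > 0\<close> \<open>\<epsilon> > 0\<close> by (simp add: field_simps)
  finally show ?thesis .
qed

text \<open>Backward differencing gives the right signs for arbitrary step sizes: at a negative
  minimum with a strictly larger left neighbour the forward quotient is nonnegative and the backward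
  quotient negative, so both terms of the operator are negative.\<close>

lemma upwind_operator_nonneg_imp_nonneg:
  assumes "\<epsilon> > 0" and h: "\<And>i. i \<in> {1..N} \<Longrightarrow> mesh_width x i > 0"
    and L: "\<And>i. i \<in> {1..N - 1} \<Longrightarrow> upwind_operator \<epsilon> x w i \<ge> 0"
    and "w 0 \<ge> 0" "w N \<ge> 0" "i \<le> N"
  shows "w i \<ge> 0"
proof (rule ccontr)
  assume neg: "\<not> w i \<ge> 0"
  define m where "m = Min (w ` {..N})"
  have m_le: "m \<le> w j" if "j \<le> N" for j
    using that by (simp add: m_def)
  have "m \<in> w ` {..N}" unfolding m_def by (rule Min_in) auto
  then have ex: "\<exists>j. j \<le> N \<and> w j = m" by auto
  \<comment> \<open>The smallest minimiser has a strictly larger left neighbour.\<close>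
  define j where "j = (LEAST j. j \<le> N \<and> w j = m)"
  have j: "j \<le> N" "w j = m" using LeastI_ex[OF ex] by (auto simp: j_def)
  have least: "w k \<noteq> m" if "k < j" for k
    using not_less_Least[of k "\<lambda>j. j \<le> N \<and> w j = m"] that j by (auto simp: j_def)
  have "m < 0" using m_le[OF \<open>i \<le> N\<close>] neg by linarith
  then have "j \<noteq> 0" "j \<noteq> N" using j assms(4,5) by (metis not_le)+
  then have jr: "j \<in> {1..N - 1}" using j by auto
  then have hp: "mesh_width x j > 0" "mesh_width x (j + 1) > 0"
    by (auto intro!: h)
  have "w (j - 1) \<noteq> m" "w (j - 1) \<ge> m" "w (j + 1) \<ge> m"
    using jr by (auto intro!: least m_le)
  then have *: "(w j - w (j - 1)) / mesh_width x j < 0"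
    "(w (j + 1) - w j) / mesh_width x (j + 1) \<ge> 0"
    using hp j by (auto simp: divide_less_0_iff)
  have "\<epsilon> * (2 / (mesh_width x j + mesh_width x (j + 1))) *
     ((w (j + 1) - w j) / mesh_width x (j + 1) - (w j - w (j - 1)) / mesh_width x j) \<ge> 0"
    using * hp \<open>\<epsilon> > 0\<close> by (intro mult_nonneg_nonneg) auto
  then have "upwind_operator \<epsilon> x w j < 0"
    unfolding upwind_operator_def using * by linarith
  then show False using L[OF jr] by linarith
qed

text \<open>The operator maps the barrier \<open>T * x j + b\<close> to the constant
  \<open>T\<close>, and the barrier dominates \<open>w\<close> in absolute value at both ends, so
  the comparison principle applies to the barrier plus and minus \<open>w\<close>. As
  \<open>x i \<le> 1\<close>, the resulting bound depends neither on \<epsilon> nor on the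
  steps.\<close>

lemma upwind_stability:
  assumes "\<epsilon> > 0" and h: "\<And>i. i \<in> {1..N} \<Longrightarrow> mesh_width x i > 0"
    and x: "x 0 \<ge> 0" "\<And>i. i \<le> N \<Longrightarrow> x i \<le> 1"
    and L: "\<And>i. i \<in> {1..N - 1} \<Longrightarrow> \<bar>upwind_operator \<epsilon> x w i\<bar> \<le> T"
    and w: "\<bar>w 0\<bar> \<le> b" "\<bar>w N\<bar> \<le> b" and "T \<ge> 0" "i \<le> N"
  shows "\<bar>w i\<bar> \<le> T + b"
proof -
  have x0: "0 \<le> x i" if "i \<le> N" for i
    using that
  proof (induction i)
    case (Suc i)
    then show ?case using h[of "Suc i"] by (simp add: mesh_width_def)
  qed (use x in auto)
  \<comment> \<open>The redundant factors 1 give the function the shape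
    \<open>a * v j + b * w j\<close> that \<open>upwind_operator_linear\<close> expects.\<close>
  have Lb: "upwind_operator \<epsilon> x (\<lambda>j. 1 * (T * x j + b * 1) + c * w j) i
      = T + c * upwind_operator \<epsilon> x w i" if "i \<in> {1..N - 1}" for i c
    using that upwind_operator_mesh[of x i \<epsilon>] h[of i] h[of "i + 1"]
      upwind_operator_linear[of \<epsilon> x T x b "\<lambda>_. 1" i]
    unfolding upwind_operator_linear by (auto simp: upwind_operator_const)
  have bar: "1 * (T * x i + b * 1) + c * w i \<ge> 0" if c: "c = 1 \<or> c = -1" for c
  proof (rule upwind_operator_nonneg_imp_nonneg[OF \<open>\<epsilon> > 0\<close> h _ _ _ \<open>i \<le> N\<close>,
      where w = "\<lambda>i. 1 * (T * x i + b * 1) + c * w i"])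
    show "0 \<le> upwind_operator \<epsilon> x (\<lambda>i. 1 * (T * x i + b * 1) + c * w i) j" if "j \<in> {1..N - 1}" for j
      using Lb[OF that, of c] L[OF that] c by auto
    have "T * x 0 \<ge> 0" "T * x N \<ge> 0" using x0 \<open>T \<ge> 0\<close> by auto
    then show "0 \<le> 1 * (T * x 0 + b * 1) + c * w 0" "0 \<le> 1 * (T * x N + b * 1) + c * w N"
      using w c by auto
  qed
  have "T * x i \<le> T * 1" using x(2)[OF \<open>i \<le> N\<close>] \<open>T \<ge> 0\<close> by (intro mult_left_mono)
  then show ?thesis using bar[of 1] bar[of "-1"] by auto
qed

section \<open>The part of the solution without boundary layer\<close>

text \<open>The hypothesis on \<open>y\<close> is the equation
  \<open>- \<epsilon> y' + y = g\<close>, which is stable when integrated backwards from 1. After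
  multiplication by \<open>exp (- t / \<epsilon>)\<close> the excess of \<open>y\<close> or
  \<open>- y\<close> over \<open>M\<close> is nondecreasing, and it is nonpositive at 1. Hence no
  power of \<open>1 / \<epsilon>\<close> enters the bound.\<close>

lemma layer_equation_bound:
  fixes y g :: "real \<Rightarrow> real"
  assumes "\<epsilon> > 0"
    and y: "\<And>x. x \<in> {0..1} \<Longrightarrow> (y has_real_derivative (y x - g x) / \<epsilon>) (at x within {0..1})"
    and g: "\<And>x. x \<in> {0..1} \<Longrightarrow> \<bar>g x\<bar> \<le> M" and "\<bar>y 1\<bar> \<le> M" and "x \<in> {0..1}"
  shows "\<bar>y x\<bar> \<le> M"
proof -
  have "\<epsilon> \<noteq> 0" using \<open>\<epsilon> > 0\<close> by simp
  have bar: "c * y x - M \<le> 0" if c: "c = 1 \<or> c = -1" for c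
  proof -
    define G where "G = (\<lambda>t. (c * y t - M) * exp (- t / \<epsilon>))"
    have dG: "(G has_real_derivative (M - c * g t) / \<epsilon> * exp (- t / \<epsilon>)) (at t within {0..1})"
      if "t \<in> {0..1}" for t
      unfolding G_def
      using \<open>\<epsilon> \<noteq> 0\<close>
      by (auto intro!: derivative_eq_intros y[OF that] simp: field_simps)
    have "G x \<le> G 1"
    proof (rule DERIV_nonneg_imp_increasing_open[of x 1 G])
      show "x \<le> 1" using \<open>x \<in> {0..1}\<close> by simp
      show "continuous_on {x..1} G"
        by (rule continuous_on_subset[OF DERIV_continuous_on[OF dG]]) (use \<open>x \<in> {0..1}\<close> in auto)
      fix t assume t: "x < t" "t < 1"
      then have t': "t \<in> {0..1}" "t \<in> interior {0..1}" using \<open>x \<in> {0..1}\<close> by auto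
      have "(G has_real_derivative (M - c * g t) / \<epsilon> * exp (- t / \<epsilon>)) (at t)"
        using dG[OF t'(1)] unfolding at_within_interior[OF t'(2)] .
      moreover have "0 \<le> M - c * g t" using g[OF t'(1)] c by auto
      then have "(M - c * g t) / \<epsilon> * exp (- t / \<epsilon>) \<ge> 0"
        using \<open>\<epsilon> > 0\<close> by simp
      ultimately show "\<exists>y. (G has_real_derivative y) (at t) \<and> 0 \<le> y" by blast
    qed
    moreover have "G 1 \<le> 0"
      using \<open>\<bar>y 1\<bar> \<le> M\<close> c by (auto simp: G_def mult_le_0_iff)
    ultimately have "(c * y x - M) * exp (- x / \<epsilon>) \<le> 0" by (simp add: G_def)
    then show ?thesis by (simp add: mult_le_0_iff)
  qed
  show ?thesis using bar[of 1] bar[of "-1"] by auto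
qed

text \<open>
  \<open>P\<close> is the solution of \<open>- \<epsilon> P' + P = f\<close> without boundary layer, singled out by \<open>P 1 = f 1\<close>;
  then \<open>P'\<close> solves the same equation with right-hand side \<open>f'\<close> and vanishes at 1.
\<close>

lemma smooth_component_exists:
  fixes f f' :: "real \<Rightarrow> real"
  assumes "\<epsilon> > 0"
    and f: "\<And>x. x \<in> {0..1} \<Longrightarrow> (f has_real_derivative f' x) (at x within {0..1})"
    and f0: "\<And>x. x \<in> {0..1} \<Longrightarrow> \<bar>f x\<bar> \<le> M0" and f1: "\<And>x. x \<in> {0..1} \<Longrightarrow> \<bar>f' x\<bar> \<le> M1"
  obtains S P Q R :: "real \<Rightarrow> real" where
    "\<And>x. x \<in> {0..1} \<Longrightarrow> (S has_real_derivative P x) (at x within {0..1})"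
    "\<And>x. x \<in> {0..1} \<Longrightarrow> (P has_real_derivative Q x) (at x within {0..1})"
    "\<And>x. x \<in> {0..1} \<Longrightarrow> (Q has_real_derivative R x) (at x within {0..1})"
    "\<And>x. - \<epsilon> * Q x + P x = f x"
    "S 0 = 0" "\<bar>S 1\<bar> \<le> M0"
    "\<And>x. x \<in> {0..1} \<Longrightarrow> \<bar>Q x\<bar> \<le> M1" "\<And>x. x \<in> {0..1} \<Longrightarrow> \<epsilon> * \<bar>R x\<bar> \<le> 2 * M1"
proof -
  have "\<epsilon> \<noteq> 0" using \<open>\<epsilon> > 0\<close> by simp
  have cf: "continuous_on {0..1} f" using f by (rule DERIV_continuous_on)
  obtain F where F: "\<And>x. x \<in> {0..1} \<Longrightarrow> (F has_real_derivative f x) (at x within {0..1})"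
    using antiderivative_continuous[OF cf]
    by (auto simp: has_real_derivative_iff_has_vector_derivative)
  have "continuous_on {0..1} (\<lambda>x. - f x * exp (- x / \<epsilon>) / \<epsilon>)"
    using \<open>\<epsilon> > 0\<close> by (intro continuous_intros cf) auto
  then obtain G where G: "\<And>x. x \<in> {0..1} \<Longrightarrow>
      (G has_real_derivative (- f x * exp (- x / \<epsilon>) / \<epsilon>)) (at x within {0..1})"
    using antiderivative_continuous[of 0 1 "\<lambda>x. - f x * exp (- x / \<epsilon>) / \<epsilon>"]
    by (auto simp: has_real_derivative_iff_has_vector_derivative)
  \<comment> \<open>Variation of constants. The additive constant enforces \<open>P 1 = f 1\<close>,
    so that \<open>Q 1 = 0\<close> instead of a multiple of \<open>1 / \<epsilon>\<close>.\<close>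
  define P where "P = (\<lambda>x. exp (x / \<epsilon>) * (G x - G 1 + f 1 * exp (- 1 / \<epsilon>)))"
  define Q where "Q = (\<lambda>x. (P x - f x) / \<epsilon>)"
  define R where "R = (\<lambda>x. (Q x - f' x) / \<epsilon>)"
  \<comment> \<open>Since \<open>P = \<epsilon> Q + f\<close> and \<open>Q = P'\<close>, an
    antiderivative of \<open>P\<close> is \<open>\<epsilon> P + F\<close>; it is normalised to
    vanish at 0.\<close>
  define S where "S = (\<lambda>x. \<epsilon> * (P x - P 0) + (F x - F 0))"
  have dP: "(P has_real_derivative Q x) (at x within {0..1})" if "x \<in> {0..1}" for x
    unfolding P_def Q_def
    by (rule derivative_eq_intros G[OF that] refl \<open>\<epsilon> \<noteq> 0\<close>)+
      (use \<open>\<epsilon> > 0\<close> in \<open>simp add: field_simps exp_minus\<close>)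
  have dQ: "(Q has_real_derivative R x) (at x within {0..1})" if "x \<in> {0..1}" for x
    unfolding Q_def R_def
    by (rule derivative_eq_intros dP[OF that] f[OF that] refl \<open>\<epsilon> \<noteq> 0\<close>)+ (use \<open>\<epsilon> > 0\<close> in \<open>auto simp: Q_def\<close>)
  have dS: "(S has_real_derivative P x) (at x within {0..1})" if "x \<in> {0..1}" for x
    unfolding S_def
    by (rule derivative_eq_intros dP[OF that] F[OF that] refl \<open>\<epsilon> \<noteq> 0\<close>)+
      (use \<open>\<epsilon> > 0\<close> in \<open>simp add: Q_def field_simps\<close>)
  have P1: "P 1 = f 1" by (simp add: P_def exp_minus field_simps)
  have P_le: "\<bar>P x\<bar> \<le> M0" if "x \<in> {0..1}" for x
    using dP P1 f0 that
    by (intro layer_equation_bound[OF \<open>\<epsilon> > 0\<close>, of P f M0 x]) (simp_all add: Q_def)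
  have "0 \<le> M1" using f1[of 1] by auto
  then have Q_le: "\<bar>Q x\<bar> \<le> M1" if "x \<in> {0..1}" for x
    using dQ P1 f1 that
    by (intro layer_equation_bound[OF \<open>\<epsilon> > 0\<close>, of Q f' M1 x]) (simp_all add: R_def Q_def)
  have "norm (S 1 - S 0) \<le> M0 * norm (1 - 0 :: real)"
    by (rule field_differentiable_bound[of "{0..1}" S P]) (use dS P_le in auto)
  moreover have S0: "S 0 = 0" by (simp add: S_def)
  ultimately have S1: "\<bar>S 1\<bar> \<le> M0" by simp
  have R_le: "\<epsilon> * \<bar>R x\<bar> \<le> 2 * M1" if "x \<in> {0..1}" for x
    using Q_le[OF that] f1[OF that] \<open>\<epsilon> > 0\<close> by (simp add: R_def)
  have eq: "- \<epsilon> * Q x + P x = f x" for x using \<open>\<epsilon> > 0\<close> by (simp add: Q_def)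
  show thesis using that[OF dS dP dQ eq S0 S1 Q_le R_le] .
qed

section \<open>Consistency of the scheme\<close>

text \<open>The third derivative \<open>R\<close> enters only through the diffusion term, hence
  multiplied by \<epsilon>, and that product is bounded by hypothesis. So the scheme is of first
  order uniformly in \<epsilon>, also where two different steps meet. The factor 5 is 4 from
  diffusion plus 1 from convection.\<close>

lemma upwind_truncation_error:
  fixes S P Q R :: "real \<Rightarrow> real"
  assumes "\<epsilon> > 0"
    and dS: "\<And>x. x \<in> {0..1} \<Longrightarrow> (S has_real_derivative P x) (at x within {0..1})"
    and dP: "\<And>x. x \<in> {0..1} \<Longrightarrow> (P has_real_derivative Q x) (at x within {0..1})"
    and dQ: "\<And>x. x \<in> {0..1} \<Longrightarrow> (Q has_real_derivative R x) (at x within {0..1})"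
    and Q: "\<And>x. x \<in> {0..1} \<Longrightarrow> \<bar>Q x\<bar> \<le> M"
    and R: "\<And>x. x \<in> {0..1} \<Longrightarrow> \<epsilon> * \<bar>R x\<bar> \<le> 2 * M"
    and h: "mesh_width x i > 0" "mesh_width x (i + 1) > 0"
    and x: "x (i - 1) \<in> {0..1}" "x i \<in> {0..1}" "x (i + 1) \<in> {0..1}"
    and d: "mesh_width x i \<le> d" "mesh_width x (i + 1) \<le> d"
  shows "\<bar>upwind_operator \<epsilon> x (\<lambda>i. S (x i)) i - (- \<epsilon> * Q (x i) + P (x i))\<bar> \<le> 5 * M * d"
proof -
  define D :: "nat \<Rightarrow> real \<Rightarrow> real" where "D = (\<lambda>n. [S, P, Q, R] ! n)"
  have D [simp]: "D 0 = S" "D (Suc 0) = P" "D (Suc (Suc 0)) = Q" "D (Suc (Suc (Suc 0))) = R"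
    by (simp_all add: D_def)
  define K where "K = 2 * M / \<epsilon>"
  have RK: "\<bar>R t\<bar> \<le> K" if "t \<in> {0..1}" for t
    using R[OF that] \<open>\<epsilon> > 0\<close> by (simp add: K_def field_simps)
  have "M \<ge> 0" using Q[OF x(2)] by linarith
  have dD: "(D k has_real_derivative D (Suc k) t) (at t within {0..1})"
    if "t \<in> {0..1}" "k \<le> 2" for t k
    using that dS dP dQ by (auto simp: le_Suc_eq numeral_2_eq_2)
  \<comment> \<open>\<open>field_Taylor\<close> with \<open>n\<close> terms after the constant has
    remainder \<open>B * norm (z - w) ^ (n + 1) / fact n\<close>; hence the denominators 2 here and
    1 in \<open>taylor1\<close>.\<close>
  have taylor2: "\<bar>S z - (S w + P w * (z - w) + Q w * (z - w)\<^sup>2 / 2)\<bar> \<le> K * \<bar>z - w\<bar> ^ 3 / 2"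
    if "z \<in> {0..1}" "w \<in> {0..1}" for z w
    using field_Taylor[of "{0..1}" 2 D K w z] dD RK that
    by (simp add: numeral_2_eq_2 numeral_3_eq_3 eval_nat_numeral algebra_simps)
  have taylor1: "\<bar>S z - (S w + P w * (z - w))\<bar> \<le> M * \<bar>z - w\<bar> ^ 2"
    if "z \<in> {0..1}" "w \<in> {0..1}" for z w
    using field_Taylor[of "{0..1}" 1 D M w z] dD Q that
    by (simp add: numeral_2_eq_2 algebra_simps)
  define a b y where "a = mesh_width x i" and "b = mesh_width x (i + 1)" and "y = x i"
  have ab: "a > 0" "b > 0" "a \<le> d" "b \<le> d" using h d by (auto simp: a_def b_def)
  have y: "y \<in> {0..1}" using x by (simp add: y_def)
  have xa: "x (i - 1) - y = - a" and xb: "x (i + 1) - y = b"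
    by (simp_all add: a_def b_def y_def mesh_width_def)
  \<comment> \<open>\<open>e1\<close> and \<open>e2\<close> are second-order Taylor remainders of
    the two quotients in the diffusion term. In their difference \<open>P y\<close> cancels and
    \<open>Q y\<close> keeps the factor \<open>(a + b) / 2\<close>, which the weight
    \<open>2 / (a + b)\<close> removes exactly. For convection the first-order remainder
    \<open>e3\<close> suffices.\<close>
  define e1 where "e1 = (S (x (i + 1)) - S y) / b - (P y + Q y * b / 2)"
  define e2 where "e2 = (S y - S (x (i - 1))) / a - (P y - Q y * a / 2)"
  define e3 where "e3 = (S y - S (x (i - 1))) / a - P y"
  have e1: "\<bar>e1\<bar> \<le> K * b\<^sup>2 / 2"
  proof -
    have "e1 * b = S (x (i + 1)) - (S y + P y * b + Q y * b\<^sup>2 / 2)"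
      using ab by (simp add: e1_def field_simps power2_eq_square)
    then have "\<bar>e1 * b\<bar> \<le> (K * b\<^sup>2 / 2) * b"
      using taylor2[OF x(3) y] xb ab by (simp add: power2_eq_square power3_eq_cube)
    then show ?thesis using ab by (simp add: abs_mult)
  qed
  have e2: "\<bar>e2\<bar> \<le> K * a\<^sup>2 / 2"
  proof -
    have "e2 * a = - (S (x (i - 1)) - (S y + P y * (- a) + Q y * (- a)\<^sup>2 / 2))"
      using ab by (simp add: e2_def field_simps power2_eq_square)
    then have "\<bar>e2 * a\<bar> \<le> (K * a\<^sup>2 / 2) * a"
      using taylor2[OF x(1) y] ab unfolding xa abs_minus_cancel
      by (simp add: power2_eq_square power3_eq_cube abs_minus_commute)
    then show ?thesis using ab by (simp add: abs_mult)
  qed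
  have e3: "\<bar>e3\<bar> \<le> M * a"
  proof -
    have "e3 * a = - (S (x (i - 1)) - (S y + P y * (- a)))"
      using ab by (simp add: e3_def field_simps)
    then have "\<bar>e3 * a\<bar> \<le> (M * a) * a"
      using taylor1[OF x(1) y] ab unfolding xa abs_minus_cancel
      by (simp add: power2_eq_square)
    then show ?thesis using ab by (simp add: abs_mult)
  qed
  have "upwind_operator \<epsilon> x (\<lambda>i. S (x i)) i - (- \<epsilon> * Q (x i) + P (x i))
      = - \<epsilon> * (2 / (a + b)) * ((S (x (i + 1)) - S y) / b - (S y - S (x (i - 1))) / a)
        + \<epsilon> * Q y + e3"
    by (simp add: upwind_operator_def a_def b_def y_def e3_def)
  also have "\<dots> = - (\<epsilon> * (2 / (a + b))) * (e1 - e2) + e3"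
  proof -
    have l1: "(S (x (i + 1)) - S y) / b - (S y - S (x (i - 1))) / a = (e1 - e2) + Q y * ((a + b) / 2)"
      by (simp add: e1_def e2_def field_simps)
    have l2: "\<epsilon> * (2 / (a + b)) * (Q y * ((a + b) / 2)) = \<epsilon> * Q y"
      using ab by simp
    have l3: "- k * (e + t) + z + e3 = - k * e + e3" if "k * t = z" for k e t z :: real
      using that by (simp add: algebra_simps)
    show ?thesis unfolding l1 using l3[OF l2] by (simp only: mult_minus_left)
  qed
  finally have eq: "upwind_operator \<epsilon> x (\<lambda>i. S (x i)) i - (- \<epsilon> * Q (x i) + P (x i))
      = - (\<epsilon> * (2 / (a + b))) * (e1 - e2) + e3" .
  have "\<bar>- (\<epsilon> * (2 / (a + b))) * (e1 - e2)\<bar> = (\<epsilon> * (2 / (a + b))) * \<bar>e1 - e2\<bar>"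
    using ab \<open>\<epsilon> > 0\<close> by (simp add: abs_mult)
  \<comment> \<open>Replacing the sum of squares by \<open>(a + b)\<^sup>2\<close> lets the weight
    cancel one factor \<open>a + b\<close>, and \<open>\<epsilon> * K = 2 * M\<close> then removes
    \<epsilon>.\<close>
  also have "\<dots> \<le> (\<epsilon> * (2 / (a + b))) * (K * (a + b)\<^sup>2 / 2)"
  proof (rule mult_left_mono)
    have "K \<ge> 0" using \<open>M \<ge> 0\<close> \<open>\<epsilon> > 0\<close> by (simp add: K_def)
    then have "0 \<le> K * (a * b)" using ab by simp
    then have "K * b\<^sup>2 / 2 + K * a\<^sup>2 / 2 \<le> K * (a + b)\<^sup>2 / 2"
      by (simp add: power2_eq_square algebra_simps)
    then show "\<bar>e1 - e2\<bar> \<le> K * (a + b)\<^sup>2 / 2" using e1 e2 by linarith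
  qed (use ab \<open>\<epsilon> > 0\<close> in auto)
  also have "\<dots> = 2 * M * (a + b)"
    using ab \<open>\<epsilon> > 0\<close> by (simp add: K_def power2_eq_square)
  finally have "\<bar>upwind_operator \<epsilon> x (\<lambda>i. S (x i)) i - (- \<epsilon> * Q (x i) + P (x i))\<bar>
      \<le> 2 * M * (a + b) + M * a"
    unfolding eq using e3 by linarith
  also have "\<dots> \<le> 2 * M * (d + d) + M * d"
    using ab \<open>M \<ge> 0\<close> by (intro add_mono mult_left_mono) auto
  finally show ?thesis by simp
qed

section \<open>Splitting off the boundary layer of the exact solution\<close>

text \<open>The difference \<open>u - S\<close> solves the homogeneous equation, whose solutions are
  spanned by constants and \<open>exp (x / \<epsilon>)\<close>; vanishing at 0 leaves one free
  parameter.\<close>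

lemma bvp_solution_decomposition:
  fixes S P Q :: "real \<Rightarrow> real"
  assumes "\<epsilon> > 0" and u: "bvp_solution \<epsilon> f u"
    and dS: "\<And>x. x \<in> {0..1} \<Longrightarrow> (S has_real_derivative P x) (at x within {0..1})"
    and dP: "\<And>x. x \<in> {0..1} \<Longrightarrow> (P has_real_derivative Q x) (at x within {0..1})"
    and eq: "\<And>x. - \<epsilon> * Q x + P x = f x" and "S 0 = 0"
  obtains c where "\<And>x. x \<in> {0..1} \<Longrightarrow> u x = S x + c * (exp (- (1 - x) / \<epsilon>) - exp (- 1 / \<epsilon>))"
proof -
  have "\<epsilon> \<noteq> 0" using \<open>\<epsilon> > 0\<close> by simp
  have at: "at x within {0..1} = at x" if "x \<in> {0<..<1}" for x :: real
    using that by (intro at_within_interior) auto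
  have du: "(u has_real_derivative deriv u x) (at x)"
    and ddu: "(deriv u has_real_derivative deriv (deriv u) x) (at x)"
    and ode: "- \<epsilon> * deriv (deriv u) x + deriv u x = f x" if "x \<in> {0<..<1}" for x
    using u that by (auto simp: bvp_solution_def DERIV_deriv_iff_real_differentiable)
  \<comment> \<open>First integration, with integrating factor
    \<open>exp (- x / \<epsilon>)\<close>. It stays in the open interval, where the derivatives of
    \<open>u\<close> are available.\<close>
  define E where "E = (\<lambda>x. (deriv u x - P x) * exp (- x / \<epsilon>))"
  have "(E has_real_derivative 0) (at x within {0<..<1})" if x: "x \<in> {0<..<1}" for x
  proof -
    have dPx: "(P has_real_derivative Q x) (at x)" using dP[of x] x at[OF x] by auto
    have "(E has_real_derivative
        (deriv (deriv u) x - Q x) * exp (- x / \<epsilon>) - (deriv u x - P x) * exp (- x / \<epsilon>) / \<epsilon>) (at x)"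
      unfolding E_def using \<open>\<epsilon> \<noteq> 0\<close>
      by (auto intro!: derivative_eq_intros ddu[OF x] dPx simp: field_simps)
    moreover have "deriv u x - P x = \<epsilon> * (deriv (deriv u) x - Q x)"
      using ode[OF x] eq[of x] by (simp add: algebra_simps)
    ultimately show ?thesis
      using \<open>\<epsilon> \<noteq> 0\<close> by (auto intro: has_field_derivative_at_within)
  qed
  then obtain k where k: "\<And>x. x \<in> {0<..<1} \<Longrightarrow> E x = k"
    using has_field_derivative_zero_constant[OF convex_real_interval(8), of 0 1 E] by blast
  \<comment> \<open>Second integration. Continuity of \<open>u\<close> on the closed interval
    carries the constancy of \<open>W\<close> to the end points, where the boundary values are
    used.\<close>
  define W where "W = (\<lambda>x. u x - S x - k * \<epsilon> * exp (x / \<epsilon>))"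
  have W: "W x = W 0" if "x \<in> {0..1}" for x
  proof (rule DERIV_isconst2[of 0 1])
    have "continuous_on {0..1} u" "continuous_on {0..1} S"
      using u DERIV_continuous_on[OF dS] by (auto simp: bvp_solution_def)
    then show "continuous_on {0..1} W"
      unfolding W_def using \<open>\<epsilon> \<noteq> 0\<close> by (intro continuous_intros) auto
    fix t :: real assume "0 < t" "t < 1"
    then have t: "t \<in> {0<..<1}" by simp
    have dSt: "(S has_real_derivative P t) (at t)" using dS[of t] t at[OF t] by auto
    have "(W has_real_derivative (deriv u t - P t) - k * exp (t / \<epsilon>)) (at t)"
      unfolding W_def using \<open>\<epsilon> \<noteq> 0\<close>
      by (auto intro!: derivative_eq_intros du[OF t] dSt simp: field_simps)
    moreover have "deriv u t - P t = k * exp (t / \<epsilon>)"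
    proof -
      have "exp (- t / \<epsilon>) * exp (t / \<epsilon>) = 1" by (simp add: mult_exp_exp)
      moreover have "(deriv u t - P t) * exp (- t / \<epsilon>) * exp (t / \<epsilon>) = k * exp (t / \<epsilon>)"
        using k[OF t] by (simp only: E_def)
      ultimately show ?thesis by (simp only: mult.assoc mult_1_right)
    qed
    ultimately show "(W has_real_derivative 0) (at t)" by simp
  qed (use that in auto)
  \<comment> \<open>The factor \<open>exp (1 / \<epsilon>)\<close> is moved into the constant, so
    that the layer function equals 1 at the right end.\<close>
  have "u x = S x + (k * \<epsilon> * exp (1 / \<epsilon>)) * (exp (- (1 - x) / \<epsilon>) - exp (- 1 / \<epsilon>))"
    if "x \<in> {0..1}" for x
  proof -
    have "u 0 = 0" using u by (simp add: bvp_solution_def)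
    then have "u x = S x + k * \<epsilon> * (exp (x / \<epsilon>) - 1)"
      using W[OF that] \<open>S 0 = 0\<close> by (simp add: W_def algebra_simps)
    moreover have "exp (1 / \<epsilon>) * exp (- (1 - x) / \<epsilon>) = exp (x / \<epsilon>)"
      unfolding mult_exp_exp by (simp add: diff_divide_distrib)
    moreover have "exp (1 / \<epsilon>) * exp (- 1 / \<epsilon>) = 1"
      by (simp add: mult_exp_exp)
    moreover have "k * \<epsilon> * (z - 1) = k * \<epsilon> * a * (y - w)" if "a * y = z" "a * w = 1" for a y z w
      by (simp only: mult.assoc right_diff_distrib that)
    ultimately show ?thesis by (simp only:)
  qed
  then show thesis using that by blast
qed

section \<open>The discrete layer function\<close>

text \<open>With \<open>a = 1 / (1 + s)\<close> and \<open>b = exp (- s)\<close>, the defect of one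
  step is at most \<open>s * (1 - a)\<close>, while earlier errors are damped by \<open>a\<close>.
  As \<open>a * s + s * (1 - a) = s\<close>, the bound \<open>s\<close> reproduces itself and is
  uniform in \<open>k\<close>.\<close>

lemma inverse_power_exp_diff_le:
  fixes s :: real
  assumes "s > 0"
  shows "exp (- (real k * s)) \<le> (1 / (1 + s)) ^ k" (is ?lower)
    and "(1 / (1 + s)) ^ k - exp (- (real k * s)) \<le> s" (is ?upper)
proof -
  define a b where "a = 1 / (1 + s)" and "b = exp (- s)"
  have b: "exp (- (real j * s)) = b ^ j" for j
    using exp_of_nat_mult[of j "- s"] by (simp add: b_def)
  have "b \<le> a"
    using \<open>s > 0\<close> exp_ge_add_one_self[of s] unfolding a_def b_def exp_minus
    by (simp add: field_simps)
  then show ?lower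
    unfolding b a_def[symmetric] by (intro power_mono) (auto simp: b_def)
  have step: "a - b \<le> s * (1 - a)"
  proof -
    have "1 - s \<le> b" using exp_ge_add_one_self[of "- s"] by (simp add: b_def)
    moreover have "a - (1 - s) = s * (1 - a)"
      using \<open>s > 0\<close> by (simp add: a_def field_simps)
    ultimately show ?thesis by linarith
  qed
  have a: "0 \<le> a" "0 \<le> b" "b \<le> 1" using \<open>s > 0\<close> by (auto simp: a_def b_def)
  have "a ^ k - b ^ k \<le> s"
  proof (induction k)
    case (Suc k)
    have "b ^ k \<le> 1" using a by (intro power_le_one)
    then have "(a - b) * b ^ k \<le> (a - b) * 1"
      using \<open>b \<le> a\<close> by (intro mult_left_mono) auto
    moreover have "a * (a ^ k - b ^ k) \<le> a * s" using Suc a by (intro mult_left_mono)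
    moreover have "a ^ Suc k - b ^ Suc k = a * (a ^ k - b ^ k) + (a - b) * b ^ k"
      by (simp add: algebra_simps)
    moreover have "a * s + s * (1 - a) = s" by (simp add: algebra_simps)
    ultimately show ?case using step unfolding mult_1_right by linarith
  qed (use \<open>s > 0\<close> in simp)
  then show ?upper by (simp add: b a_def)
qed

text \<open>On a uniform stretch the difference quotients grow by a fixed factor, so
  \<open>Z\<close> is a power of \<open>\<rho>\<close> on the fine part and a constant plus a
  multiple of a power of \<open>r\<close> on the coarse part. The two pieces are matched at node
  \<open>n\<close>.\<close>

lemma discrete_layer_exists:
  fixes x :: "nat \<Rightarrow> real"
  assumes "\<epsilon> > 0" "n > 0" "H > 0" "h > 0"
    and H: "\<And>i. i \<in> {1..n} \<Longrightarrow> mesh_width x i = H"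
    and h: "\<And>i. i \<in> {n + 1..2 * n} \<Longrightarrow> mesh_width x i = h"
  obtains Z where "\<And>i. i \<in> {1..2 * n - 1} \<Longrightarrow> upwind_operator \<epsilon> x Z i = 0"
    and "\<And>i. i \<in> {n..2 * n} \<Longrightarrow> Z i = (1 / (1 + h / \<epsilon>)) ^ (2 * n - i)"
    and "\<And>i. i \<le> n \<Longrightarrow> \<bar>Z i\<bar> \<le> (1 / (1 + h / \<epsilon>)) ^ n"
proof -
  define \<rho> where "\<rho> = 1 / (1 + h / \<epsilon>)"
  define r where "r = 1 / (1 + H / \<epsilon>)"
  define p where "p = \<rho> ^ n"
  \<comment> \<open>Solves the equation at node \<open>n\<close>: the right quotient is
    \<open>p / \<epsilon>\<close>, the left one is \<open>c / (H + \<epsilon>)\<close>, and the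
    recursion relates them by \<open>1 + (H + h) / (2 * \<epsilon>)\<close>. As
    \<open>0 \<le> c \<le> 2 * p\<close>, \<open>Z\<close> stays between \<open>- p\<close> and
    \<open>p\<close> on the coarse part.\<close>
  define c where "c = 2 * p * (H + \<epsilon>) / (2 * \<epsilon> + H + h)"
  define Z where "Z = (\<lambda>i. if i \<le> n then p - c * (1 - r ^ (n - i)) else \<rho> ^ (2 * n - i))"
  have \<rho>: "\<rho> > 0" and r: "r > 0" "r \<le> 1"
    using assms(1-4) by (simp_all add: \<rho>_def r_def divide_simps)
  have "p > 0" using \<rho> by (simp add: p_def)
  have Zr: "Z i = \<rho> ^ (2 * n - i)" if "i \<in> {n..2 * n}" for i
  proof (cases "i = n")
    case True
    moreover have "2 * n - n = n" by simp
    ultimately show ?thesis by (simp only: Z_def p_def) simp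
  qed (use that in \<open>auto simp: Z_def\<close>)
  have "upwind_operator \<epsilon> x Z i = 0" if i: "i \<in> {1..2 * n - 1}" for i
  proof (rule upwind_operator_eq_0[OF \<open>\<epsilon> > 0\<close>])
    have w: "mesh_width x i = (if i \<le> n then H else h)"
      "mesh_width x (i + 1) = (if i < n then H else h)"
      using i by (auto intro!: H h)
    then show "mesh_width x i > 0" "mesh_width x (i + 1) > 0" using assms(3,4) by auto
    consider "i < n" | "i = n" | "i > n" by linarith
    then show "(Z (i + 1) - Z i) / mesh_width x (i + 1) = (Z i - Z (i - 1)) / mesh_width x i *
         (1 + (mesh_width x i + mesh_width x (i + 1)) / (2 * \<epsilon>))"
    proof cases
      case 1
      then obtain m where m: "n = i + 1 + m" using less_iff_Suc_add[of i n] by auto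
      have "n - i = Suc m" "n - (i + 1) = m" "n - (i - 1) = Suc (Suc m)" "i - 1 \<le> n" using m i by auto
      then have "Z (i + 1) - Z i = c * r ^ m * (1 - r)" "Z i - Z (i - 1) = r * (c * r ^ m * (1 - r))"
        using 1 by (simp_all add: Z_def algebra_simps)
      moreover have "1 + (H + H) / (2 * \<epsilon>) = 1 / r" using \<open>\<epsilon> > 0\<close> by (simp add: r_def)
      ultimately show ?thesis using w 1 r by simp
    next
      \<comment> \<open>The transition node, where the two step sizes meet; both sides of the
        recursion evaluate to \<open>p / \<epsilon>\<close>.\<close>
      case 2
      have "2 * n - (n + 1) = n - 1" by simp
      then have "Z (n + 1) = \<rho> ^ (n - 1)" using Zr[of "n + 1"] \<open>n > 0\<close> by simp
      moreover have "p = \<rho> * \<rho> ^ (n - 1)" using \<open>n > 0\<close> by (simp add: p_def power_eq_if)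
      ultimately have p1: "Z (n + 1) = p / \<rho>" using \<rho> by simp
      have "n - (n - 1) = 1" using \<open>n > 0\<close> by simp
      then have "Z n - Z (n - 1) = c * (1 - r)" "Z n = p" by (simp_all add: Z_def)
      moreover have "1 - r = H / (H + \<epsilon>)" using assms by (simp add: r_def field_simps)
      ultimately have "(Z n - Z (n - 1)) / H = 2 * p / (2 * \<epsilon> + H + h)"
        using assms(1-4) by (simp add: c_def)
      moreover have "1 + (H + h) / (2 * \<epsilon>) = (2 * \<epsilon> + H + h) / (2 * \<epsilon>)"
        using \<open>\<epsilon> > 0\<close> by (simp add: field_simps)
      moreover have "2 * \<epsilon> + H + h > 0" using assms by simp
      ultimately have "(Z n - Z (n - 1)) / H * (1 + (H + h) / (2 * \<epsilon>)) = p / \<epsilon>"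
        by simp
      moreover have "(Z (n + 1) - Z n) / h = p / \<epsilon>"
        unfolding p1 \<open>Z n = p\<close> using assms(1-4) by (simp add: \<rho>_def field_simps)
      ultimately show ?thesis using w 2 by simp
    next
      case 3
      then obtain m where m: "2 * n = i + 1 + m" using i less_iff_Suc_add[of i "2 * n"] by auto
      have "2 * n - i = Suc m" "2 * n - (i + 1) = m" "2 * n - (i - 1) = Suc (Suc m)"
        "i + 1 \<in> {n..2 * n}" "i \<in> {n..2 * n}" "i - 1 \<in> {n..2 * n}"
        using m i 3 by auto
      then have "Z (i + 1) - Z i = \<rho> ^ m * (1 - \<rho>)" "Z i - Z (i - 1) = \<rho> * (\<rho> ^ m * (1 - \<rho>))"
        using Zr[of "i + 1"] Zr[of i] Zr[of "i - 1"] by (simp_all add: algebra_simps)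
      moreover have "1 + (h + h) / (2 * \<epsilon>) = 1 / \<rho>" using \<open>\<epsilon> > 0\<close> by (simp add: \<rho>_def)
      ultimately show ?thesis using w 3 \<rho> by simp
    qed
  qed
  moreover have "\<bar>Z i\<bar> \<le> p" if "i \<le> n" for i
  proof -
    have "c \<le> 2 * p"
      using \<open>p > 0\<close> assms(1-4) by (simp add: c_def field_simps)
    moreover have "c \<ge> 0" using \<open>p > 0\<close> assms(1-4) by (simp add: c_def)
    moreover have "0 \<le> 1 - r ^ (n - i)" "1 - r ^ (n - i) \<le> 1"
      using r by (simp_all add: power_le_one)
    ultimately have "0 \<le> c * (1 - r ^ (n - i))" "c * (1 - r ^ (n - i)) \<le> 2 * p * 1"
      using \<open>p > 0\<close> by (intro mult_nonneg_nonneg mult_mono; simp)+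
    then show ?thesis using that by (simp add: Z_def)
  qed
  ultimately show thesis using that Zr unfolding \<rho>_def p_def by blast
qed

section \<open>Error bound on a mesh with two step sizes\<close>

text \<open>The Shishkin choice of the transition point does not enter yet. The layer error
  \<open>b\<close> is counted twice, once for the boundary values in the stability bound and once
  for exchanging \<open>Z\<close> with the exact layer; this turns \<open>2 * M0\<close> into
  \<open>4 * M0\<close>.\<close>

lemma upwind_error_piecewise_uniform:
  fixes f f' u :: "real \<Rightarrow> real" and x v :: "nat \<Rightarrow> real"
  assumes "\<epsilon> > 0" "\<epsilon> \<le> 1" "n > 0" "H > 0" "h > 0"
    and f: "\<And>t. t \<in> {0..1} \<Longrightarrow> (f has_real_derivative f' t) (at t within {0..1})"
    and f0: "\<And>t. t \<in> {0..1} \<Longrightarrow> \<bar>f t\<bar> \<le> M0" and f1: "\<And>t. t \<in> {0..1} \<Longrightarrow> \<bar>f' t\<bar> \<le> M1"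
    and u: "bvp_solution \<epsilon> f u" and v: "upwind_solution \<epsilon> f (2 * n) x v"
    and xl: "\<And>i. i \<le> n \<Longrightarrow> x i = real i * H"
    and xr: "\<And>i. i \<in> {n..2 * n} \<Longrightarrow> x i = 1 - (2 * real n - real i) * h"
    and d: "H \<le> d" "h \<le> d" and "i \<le> 2 * n"
  shows "\<bar>u (x i) - v i\<bar> \<le> 5 * M1 * d + 4 * M0 * (2 * (1 / (1 + h / \<epsilon>)) ^ n + h / \<epsilon>)"
proof -
  obtain S P Q R where
    dS: "\<And>x. x \<in> {0..1} \<Longrightarrow> (S has_real_derivative P x) (at x within {0..1})" and
    dP: "\<And>x. x \<in> {0..1} \<Longrightarrow> (P has_real_derivative Q x) (at x within {0..1})" and
    dQ: "\<And>x. x \<in> {0..1} \<Longrightarrow> (Q has_real_derivative R x) (at x within {0..1})" and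
    eq: "\<And>x. - \<epsilon> * Q x + P x = f x" and
    S: "S 0 = 0" "\<bar>S 1\<bar> \<le> M0" and
    Q: "\<And>x. x \<in> {0..1} \<Longrightarrow> \<bar>Q x\<bar> \<le> M1" and R: "\<And>x. x \<in> {0..1} \<Longrightarrow> \<epsilon> * \<bar>R x\<bar> \<le> 2 * M1"
    using smooth_component_exists[OF \<open>\<epsilon> > 0\<close> f f0 f1] by metis
  obtain c where c: "\<And>x. x \<in> {0..1} \<Longrightarrow> u x = S x + c * (exp (- (1 - x) / \<epsilon>) - exp (- 1 / \<epsilon>))"
    using bvp_solution_decomposition[OF \<open>\<epsilon> > 0\<close> u dS dP eq S(1)] by metis
  define s p where "s = h / \<epsilon>" and "p = (1 / (1 + h / \<epsilon>)) ^ n"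
  have "s > 0" "p > 0" using assms(1,5) by (simp_all add: s_def p_def add_pos_pos)
  have "M0 \<ge> 0" "M1 \<ge> 0" "d \<ge> 0" using f0[of 0] f1[of 0] d \<open>h > 0\<close> by auto
  \<comment> \<open>At 1 the decomposition gives
    \<open>c * (1 - exp (- 1 / \<epsilon>)) = - S 1\<close>, and \<open>\<epsilon> \<le> 1\<close>
    keeps the bracket above 1/2.\<close>
  have c_le: "\<bar>c\<bar> \<le> 2 * M0"
  proof -
    have "exp 1 \<le> exp (1 / \<epsilon>)" using assms(1,2) by simp
    moreover have "2 \<le> exp (1 :: real)" using exp_ge_add_one_self[of 1] by simp
    ultimately have "2 \<le> exp (1 / \<epsilon>)" by linarith
    then have half: "exp (- 1 / \<epsilon>) \<le> 1 / 2" by (simp add: exp_minus field_simps)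
    have "u 1 = 0" using u by (simp add: bvp_solution_def)
    then have "S 1 = - (c * (1 - exp (- 1 / \<epsilon>)))" using c[of 1] by simp
    then have "\<bar>c\<bar> * (1 - exp (- 1 / \<epsilon>)) \<le> M0" using S(2) half by (simp add: abs_mult)
    moreover have "\<bar>c\<bar> * (1 / 2) \<le> \<bar>c\<bar> * (1 - exp (- 1 / \<epsilon>))"
      using half by (intro mult_left_mono) auto
    ultimately show ?thesis by simp
  qed
  have mwl: "mesh_width x i = H" if "i \<in> {1..n}" for i
    using that xl[of i] xl[of "i - 1"] by (auto simp: mesh_width_def of_nat_diff algebra_simps)
  have mwr: "mesh_width x i = h" if "i \<in> {n + 1..2 * n}" for i
  proof -
    have "i \<in> {n..2 * n}" "i - 1 \<in> {n..2 * n}" using that by auto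
    then show ?thesis
      using that xr[of i] xr[of "i - 1"] by (auto simp: mesh_width_def of_nat_diff algebra_simps)
  qed
  have mw: "mesh_width x i > 0" "mesh_width x i \<le> d" if "i \<in> {1..2 * n}" for i
    using that mwl[of i] mwr[of i] d \<open>H > 0\<close> \<open>h > 0\<close> by (cases "i \<le> n"; simp)+
  \<comment> \<open>Both descriptions of the mesh cover node \<open>n\<close>; equating them says
    that the two parts fill the unit interval.\<close>
  have nH: "real n * H = 1 - real n * h" using xl[of n] xr[of n] by simp
  have x01: "x i \<in> {0..1}" if "i \<le> 2 * n" for i
  proof (cases "i \<le> n")
    case True
    then have "real i * H \<le> real n * H" using \<open>H > 0\<close> by simp
    moreover have "real n * h \<ge> 0" using \<open>h > 0\<close> by simp
    ultimately show ?thesis using True nH \<open>H > 0\<close> by (simp add: xl)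
  next
    case False
    then have "(2 * real n - real i) * h \<le> real n * h" using \<open>h > 0\<close> by (intro mult_right_mono) auto
    moreover have "real n * H \<ge> 0" using \<open>H > 0\<close> by simp
    moreover have "(2 * real n - real i) * h \<ge> 0" using that \<open>h > 0\<close> by simp
    ultimately show ?thesis using False nH that by (simp add: xr)
  qed
  obtain Z where Z0: "\<And>i. i \<in> {1..2 * n - 1} \<Longrightarrow> upwind_operator \<epsilon> x Z i = 0"
    and Zr: "\<And>i. i \<in> {n..2 * n} \<Longrightarrow> Z i = (1 / (1 + h / \<epsilon>)) ^ (2 * n - i)"
    and Zl: "\<And>i. i \<le> n \<Longrightarrow> \<bar>Z i\<bar> \<le> p"
    using discrete_layer_exists[OF assms(1,3,4,5) mwl mwr] unfolding p_def by metis
  define q where "q = (\<lambda>i. exp (- (1 - x i) / \<epsilon>))"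
  define b where "b = 2 * M0 * (2 * p + s)"
  have qZ: "\<bar>c * (q i - Z i)\<bar> \<le> b" if "i \<le> 2 * n" for i
  proof -
    have "\<bar>q i - Z i\<bar> \<le> 2 * p + s"
    proof (cases "i \<le> n")
      case True
      then have "real i * H \<le> real n * H" using \<open>H > 0\<close> by simp
      then have "- (1 - x i) \<le> - (real n * h)" using nH True by (simp add: xl)
      then have "- (1 - x i) / \<epsilon> \<le> - (real n * h) / \<epsilon>"
        using \<open>\<epsilon> > 0\<close> by (intro divide_right_mono) auto
      then have "q i \<le> exp (- (real n * s))" by (simp add: q_def s_def)
      also have "\<dots> \<le> p"
        using inverse_power_exp_diff_le(1)[OF \<open>s > 0\<close>, of n] by (simp add: p_def s_def)
      finally have "q i \<le> p" .
      moreover have "q i \<ge> 0" by (simp add: q_def)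
      ultimately show ?thesis using Zl[OF True] \<open>s > 0\<close> by linarith
    next
      case False
      then have i: "i \<in> {n..2 * n}" using that by simp
      have "q i = exp (- (real (2 * n - i) * s))"
        unfolding q_def xr[OF i] using i by (simp add: s_def of_nat_diff)
      then show ?thesis
        using inverse_power_exp_diff_le[OF \<open>s > 0\<close>, of "2 * n - i"] Zr[OF i] \<open>s > 0\<close> \<open>p > 0\<close>
        by (simp add: s_def)
    qed
    then show ?thesis
      unfolding abs_mult b_def using c_le \<open>M0 \<ge> 0\<close> by (intro mult_mono) auto
  qed
  \<comment> \<open>This is \<open>u - v\<close> at the nodes with the exact layer replaced by
    \<open>Z\<close>, which the operator annihilates; what remains is the truncation error of
    \<open>S\<close>. The factors 1 again fit \<open>upwind_operator_linear\<close>.\<close>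
  define w where "w = (\<lambda>i. 1 * (1 * S (x i) + (- 1) * v i) + c * (1 * Z i + (- exp (- 1 / \<epsilon>)) * 1))"
  have w: "u (x i) - v i = w i + c * (q i - Z i)" if "i \<le> 2 * n" for i
    using c[OF x01[OF that]] by (simp add: w_def q_def algebra_simps)
  have "\<bar>w i\<bar> \<le> 5 * M1 * d + b"
  proof (rule upwind_stability[OF \<open>\<epsilon> > 0\<close> mw(1)])
    show "x 0 \<ge> 0" using x01[of 0] by simp
    show "x j \<le> 1" if "j \<le> 2 * n" for j using x01[OF that] by simp
    show "\<bar>upwind_operator \<epsilon> x w j\<bar> \<le> 5 * M1 * d" if j: "j \<in> {1..2 * n - 1}" for j
    proof -
      have "upwind_operator \<epsilon> x v j = f (x j)"
        using v j by (simp add: upwind_solution_def upwind_operator_def)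
      then have "upwind_operator \<epsilon> x w j = upwind_operator \<epsilon> x (\<lambda>i. S (x i)) j - f (x j)"
        unfolding w_def upwind_operator_linear by (simp add: Z0[OF j] upwind_operator_const)
      also have "\<bar>\<dots>\<bar> \<le> 5 * M1 * d"
      proof -
        have "j \<in> {1..2 * n}" "j + 1 \<in> {1..2 * n}" "j - 1 \<le> 2 * n" "j \<le> 2 * n" "j + 1 \<le> 2 * n"
          using j by auto
        note j' = mw(1)[OF this(1)] mw(1)[OF this(2)] x01[OF this(3)] x01[OF this(4)] x01[OF this(5)]
          mw(2)[OF this(1)] mw(2)[OF this(2)]
        show ?thesis
          using upwind_truncation_error[OF \<open>\<epsilon> > 0\<close> dS dP dQ Q R j'] unfolding eq .
      qed
      finally show ?thesis .
    qed
    \<comment> \<open>The error \<open>u - v\<close> vanishes at both ends, so there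
      \<open>w\<close> equals \<open>- c * (q i - Z i)\<close> and is bounded by
      \<open>b\<close>.\<close>
    have uv: "u (x 0) - v 0 = 0" "u (x (2 * n)) - v (2 * n) = 0"
      using u v xl[of 0] xr[of "2 * n"] by (simp_all add: bvp_solution_def upwind_solution_def)
    show "\<bar>w 0\<bar> \<le> b" using w[of 0] uv qZ[of 0] by linarith
    show "\<bar>w (2 * n)\<bar> \<le> b" using w[of "2 * n"] uv qZ[of "2 * n"] by linarith
    show "5 * M1 * d \<ge> 0" using \<open>M1 \<ge> 0\<close> \<open>d \<ge> 0\<close> by simp
  qed (use \<open>i \<le> 2 * n\<close> in auto)
  then have "\<bar>u (x i) - v i\<bar> \<le> 5 * M1 * d + 2 * b"
    using w[OF \<open>i \<le> 2 * n\<close>] qZ[OF \<open>i \<le> 2 * n\<close>] by linarith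
  then show ?thesis by (simp add: b_def p_def s_def algebra_simps)
qed

section \<open>The Shishkin mesh and the final constants\<close>

text \<open>From \<open>1 / (1 + s) \<le> exp (- s + s\<^sup>2)\<close> the power is at most
  \<open>exp (- n s + n s\<^sup>2)\<close>. As \<open>2 / \<alpha> \<ge> 1\<close>, the first term
  yields the factor \<open>1 / (2 n)\<close>, while \<open>n s\<^sup>2\<close> is of order
  \<open>(ln n)\<^sup>2 / n\<close> and hence bounded.\<close>

lemma shishkin_layer_decay:
  fixes \<alpha> s :: real
  assumes "0 < \<alpha>" "\<alpha> < 1" "n > 0" and s: "real n * s = 2 / \<alpha> * ln (2 * real n)"
  shows "(1 / (1 + s)) ^ n \<le> exp (32 / \<alpha>\<^sup>2) / (2 * real n)"
proof -
  define l where "l = ln (2 * real n)"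
  have "2 * real n \<ge> 2" using \<open>n > 0\<close> by simp
  then have "l > 0" by (simp add: l_def)
  then have "real n * s > 0" using s \<open>\<alpha> > 0\<close> by (simp add: l_def[symmetric])
  then have "s > 0" using \<open>n > 0\<close> by (simp add: zero_less_mult_iff)
  have "1 / (1 + s) \<le> 1 + (- s + s\<^sup>2)"
    using \<open>s > 0\<close> by (simp add: field_simps power2_eq_square)
  also have "\<dots> \<le> exp (- s + s\<^sup>2)" by (rule exp_ge_add_one_self)
  finally have "(1 / (1 + s)) ^ n \<le> exp (- s + s\<^sup>2) ^ n"
    using \<open>s > 0\<close> by (intro power_mono) auto
  also have "\<dots> = exp (real n * (- s + s\<^sup>2))" by (simp add: exp_of_nat_mult)
  also have "real n * (- s + s\<^sup>2) \<le> - l + 32 / \<alpha>\<^sup>2"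
  proof -
    \<comment> \<open>Applying \<open>ln y \<le> y - 1\<close> to the square root gives
      \<open>l\<^sup>2 \<le> 8 n\<close>, whence the constant \<open>32 = 4 * 8\<close>.\<close>
    have "l = 2 * ln (sqrt (2 * real n))" using \<open>n > 0\<close> by (simp add: l_def ln_sqrt)
    also have "\<dots> \<le> 2 * sqrt (2 * real n)"
      using \<open>n > 0\<close> ln_le_minus_one[of "sqrt (2 * real n)"] by simp
    finally have "l\<^sup>2 \<le> (2 * sqrt (2 * real n))\<^sup>2" using \<open>l > 0\<close> by (intro power_mono) auto
    then have "l\<^sup>2 \<le> 8 * real n" by (simp add: power_mult_distrib)
    then have "4 / \<alpha>\<^sup>2 * l\<^sup>2 \<le> 4 / \<alpha>\<^sup>2 * (8 * real n)" by (intro mult_left_mono) auto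
    moreover have "(real n * s\<^sup>2) * real n = 4 / \<alpha>\<^sup>2 * l\<^sup>2"
    proof -
      have "(real n * s\<^sup>2) * real n = (real n * s)\<^sup>2" by (simp add: power2_eq_square)
      then show ?thesis unfolding s l_def by (simp add: power_mult_distrib power_divide)
    qed
    ultimately have "(real n * s\<^sup>2) * real n \<le> (32 / \<alpha>\<^sup>2) * real n" by simp
    then have "real n * s\<^sup>2 \<le> 32 / \<alpha>\<^sup>2"
      by (rule mult_right_le_imp_le) (use \<open>n > 0\<close> in simp)
    moreover have "1 * l \<le> 2 / \<alpha> * l" using assms(1,2) \<open>l > 0\<close> by (intro mult_right_mono) auto
    ultimately show ?thesis using s by (simp add: algebra_simps l_def)
  qed
  then have "exp (real n * (- s + s\<^sup>2)) \<le> exp (- l + 32 / \<alpha>\<^sup>2)" by simp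
  also have "\<dots> = exp (32 / \<alpha>\<^sup>2) / (2 * real n)"
    using \<open>n > 0\<close> unfolding exp_add exp_minus l_def by (simp add: field_simps)
  finally show ?thesis .
qed

theorem theorem3p3:
  fixes f :: "real \<Rightarrow> real" and \<alpha> :: real
  assumes "smooth_on_interval 0 1 f"
    and "0 < \<alpha>" and "\<alpha> < 1"
  shows "\<exists>C :: real. \<forall>(\<epsilon> :: real) (N :: nat) (u :: real \<Rightarrow> real) (v :: nat \<Rightarrow> real).
           0 < \<epsilon> \<longrightarrow> \<epsilon> \<le> 1 \<longrightarrow> 0 < N \<longrightarrow> even N \<longrightarrow> (2 / \<alpha>) * \<epsilon> * ln (real N) \<le> 1 / 2 \<longrightarrow>
           bvp_solution \<epsilon> f u \<longrightarrow>
           upwind_solution \<epsilon> f N (shishkin_mesh \<epsilon> \<alpha> N) v \<longrightarrow>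
           (\<forall>i\<in>{0..N}. \<bar>u (shishkin_mesh \<epsilon> \<alpha> N i) - v i\<bar> \<le> C * (1 / real N) * ln (real N))"
proof -
  from assms(1) obtain D where D0: "\<And>x. x \<in> {0..1} \<Longrightarrow> D 0 x = f x"
    and D: "\<And>k x. x \<in> {0..1} \<Longrightarrow> (D k has_real_derivative D (Suc k) x) (at x within {0..1})"
    unfolding smooth_on_interval_def by blast
  have df: "(f has_real_derivative D 1 x) (at x within {0..1})" if "x \<in> {0..1}" for x
    using has_field_derivative_transform_within[OF D[OF that, of 0] zero_less_one that, of f] D0
    by simp
  have "\<exists>M. \<forall>x\<in>{0..1}. \<bar>D k x\<bar> \<le> M" for k
  proof -
    have "compact (D k ` {0..1})"
      using DERIV_continuous_on[of "{0..1}", OF D] by (intro compact_continuous_image) auto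
    then show ?thesis using compact_imp_bounded[of "D k ` {0..1}"] by (auto simp: bounded_iff)
  qed
  then obtain M where M: "\<And>k x. x \<in> {0..1} \<Longrightarrow> \<bar>D k x\<bar> \<le> M k" by metis
  have M0: "\<bar>f x\<bar> \<le> M 0" if "x \<in> {0..1}" for x using M[OF that, of 0] D0[OF that] by simp
  have "M 0 \<ge> 0" "M 1 \<ge> 0" using M[of 0 0] M[of 0 1] by auto
  \<comment> \<open>\<open>K\<close> collects the terms of pure order \<open>1 / N\<close>: 10 is 5
    times 2 because \<open>1 / n = 2 / N\<close>, and \<open>8 * M 0\<close> multiplies the decay
    constant of the layer.\<close>
  define K where "K = 10 * M 1 + 8 * M 0 * exp (32 / \<alpha>\<^sup>2)"
  have "K \<ge> 0" using \<open>M 0 \<ge> 0\<close> \<open>M 1 \<ge> 0\<close> by (simp add: K_def)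
  \<comment> \<open>\<open>N \<ge> 2\<close> allows the terms in \<open>K\<close> to be absorbed by
    \<open>ln N / ln 2\<close>. The second summand is \<open>4 * M 0\<close> times the
    \<open>4 / \<alpha>\<close> in \<open>h / \<epsilon>\<close>.\<close>
  define C where "C = K / ln 2 + 16 * M 0 / \<alpha>"
  have main: "\<bar>u (shishkin_mesh \<epsilon> \<alpha> N i) - v i\<bar> \<le> C * (1 / real N) * ln (real N)"
    if "0 < \<epsilon>" "\<epsilon> \<le> 1" "0 < N" "even N" and \<sigma>: "(2 / \<alpha>) * \<epsilon> * ln (real N) \<le> 1 / 2"
      and u: "bvp_solution \<epsilon> f u" and v: "upwind_solution \<epsilon> f N (shishkin_mesh \<epsilon> \<alpha> N) v"
      and "i \<le> N" for \<epsilon> N u v i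
  proof -
    obtain n where N: "N = 2 * n" using \<open>even N\<close> by blast
    then have "n > 0" using \<open>0 < N\<close> by simp
    define l where "l = ln (real N)"
    have "ln 2 \<le> l" using \<open>n > 0\<close> by (simp add: N l_def)
    then have "l > 0" using ln_gt_zero[of "2::real"] by linarith
    define \<tau> where "\<tau> = (2 / \<alpha>) * \<epsilon> * l"
    \<comment> \<open>The restriction on \<epsilon> and \<open>N\<close> selects the second argument
      of the minimum in \<open>shishkin_sigma\<close>.\<close>
    have \<tau>: "0 < \<tau>" "\<tau> \<le> 1 / 2" "shishkin_sigma \<epsilon> \<alpha> N = \<tau>"
      using \<sigma> \<open>l > 0\<close> \<open>0 < \<epsilon>\<close> \<open>0 < \<alpha>\<close> by (auto simp: \<tau>_def l_def shishkin_sigma_def)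
    define H h where "H = (1 - \<tau>) / real n" and "h = \<tau> / real n"
    define x where "x = shishkin_mesh \<epsilon> \<alpha> N"
    have x: "x j = (if j \<le> n then real j * H else (1 - \<tau>) + (real j - real n) * h)" for j
      unfolding x_def shishkin_mesh_def \<tau>(3) by (simp add: N H_def h_def Let_def)
    \<comment> \<open>The fine part is measured from 1, to match the exponent of the layer. Node
      \<open>n\<close> falls under the first branch of the mesh, so agreement there needs
      \<open>real n * h = \<tau>\<close>.\<close>
    have xr: "x j = 1 - (2 * real n - real j) * h" if "j \<in> {n..2 * n}" for j
    proof -
      have "real n * h = \<tau>" "real n * H = 1 - \<tau>" using \<open>n > 0\<close> by (simp_all add: h_def H_def)
      then show ?thesis using that by (auto simp: x algebra_simps)
    qed
    have "H > 0" "h > 0" using \<tau> \<open>n > 0\<close> by (simp_all add: H_def h_def)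
    have d: "H \<le> 1 / real n" "h \<le> 1 / real n"
      using \<tau> by (auto simp: H_def h_def intro!: divide_right_mono)
    \<comment> \<open>The transition point is proportional to \<epsilon>, so \<epsilon> cancels in
      \<open>h / \<epsilon>\<close>; the logarithm in the final rate comes from here.\<close>
    have s: "h / \<epsilon> = 4 / \<alpha> * (l / real N)"
      using \<open>0 < \<epsilon>\<close> by (simp add: h_def \<tau>_def N)
    have v': "upwind_solution \<epsilon> f (2 * n) x v" using v unfolding x_def N .
    have decay: "(1 / (1 + h / \<epsilon>)) ^ n \<le> exp (32 / \<alpha>\<^sup>2) / real N"
      using shishkin_layer_decay[OF assms(2,3) \<open>n > 0\<close>, of "h / \<epsilon>"] \<open>n > 0\<close>
      by (simp add: s N l_def)
    have "\<bar>u (x i) - v i\<bar> \<le> 5 * M 1 * (1 / real n) + 4 * M 0 * (2 * (1 / (1 + h / \<epsilon>)) ^ n + h / \<epsilon>)"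
      by (rule upwind_error_piecewise_uniform[OF that(1,2) \<open>n > 0\<close> \<open>H > 0\<close> \<open>h > 0\<close> df M0 M u v' _ xr d])
        (use \<open>i \<le> N\<close> in \<open>simp_all add: x N\<close>)
    also have "\<dots> \<le> 5 * M 1 * (1 / real n) + 4 * M 0 * (2 * (exp (32 / \<alpha>\<^sup>2) / real N) + h / \<epsilon>)"
      using decay \<open>M 0 \<ge> 0\<close> by (intro add_left_mono add_right_mono mult_left_mono) auto
    also have "\<dots> = K * (1 / real N) + 16 * M 0 / \<alpha> * (l / real N)"
      using \<open>n > 0\<close> unfolding s by (simp add: K_def N field_simps)
    also have "K * (1 / real N) \<le> K * ((l / ln 2) * (1 / real N))"
    proof (rule mult_left_mono[OF _ \<open>K \<ge> 0\<close>])
      have "1 * (1 / real N) \<le> (l / ln 2) * (1 / real N)"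
        using \<open>ln 2 \<le> l\<close> by (intro mult_right_mono) (auto simp: le_divide_eq)
      then show "1 / real N \<le> (l / ln 2) * (1 / real N)" by simp
    qed
    also have "K * ((l / ln 2) * (1 / real N)) + 16 * M 0 / \<alpha> * (l / real N) = C * (1 / real N) * l"
      by (simp add: C_def algebra_simps add_divide_distrib)
    finally show ?thesis by (simp add: x_def l_def)
  qed
  show ?thesis by (intro exI[of _ C] allI impI ballI main) auto
qed

end
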